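(* Let $(\mathscr A,\preceq,\multimap,!)$ be an exponential implicative structure. Define $a\to b := {!a}\multimap b$. Then $(\mathscr A,\preceq,\to)$ is an implicative structure. Moreover, if $S\subseteq\mathscr A$ is an exponential separator of $(\mathscr A,\preceq,\multimap,!)$, then $S$ is an intuitionistic separator of $(\mathscr A,\preceq,\to)$: it is upward closed, closed under modus ponens for $\to$ (i.e. $a\in S$ and $({!a}\multimap b)\in S$ imply $b\in S$), and contains $\mathbf K'=\bigwedge_{a,b}({!a}\multimap{!b}\multimap a)$ and $\mathbf S'=\bigwedge_{a,b,c}({!({!a}\multimap{!b}\multimap c)}\multimap{!({!a}\multimap b)}\multimap{!a}\multimap c)$.
   Context: An implicative structure $(\mathscr A,\preceq,\multimap)$ is a complete lattice with a binary operation $\multimap$ such that $a'\preceq a$, $b\preceq b'$ imply $(a\multimap b)\preceq(a'\multimap b')$, and $a\multimap\bigwedge_{b\in B}b=\bigwedge_{b\in B}(a\multimap b)$ for all $B\subseteq\mathscr A$; $\multimap$ associates to the right. An exponential implicative structure is an implicative structure together with a monotone map $!:\mathscr A\to\mathscr A$. A linear separator is a subset $S$ that is upward closed, closed under modus ponens ($a\in S$, $(a\multimap b)\in S$ imply $b\in S$), and contains $\bigwedge_a(a\multimap a)$, $\bigwedge_{a,b,c}((b\multimap c)\multimap(a\multimap b)\multimap a\multimap c)$ and $\bigwedge_{a,b,c}((a\multimap b\multimap c)\multimap b\multimap a\multimap c)$. An exponential separator is a linear separator $S$ closed under $!$ ($a\in S\Rightarrow {!a}\in S$) and containing $\mathbf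 K_!=\bigwedge_{a,b}(a\multimap{!b}\multimap a)$, $\mathbf W_!=\bigwedge_{a,b}(({!a}\multimap{!a}\multimap b)\multimap{!a}\multimap b)$, $\mathbf F=\bigwedge_{a,b}({!(a\multimap b)}\multimap{!a}\multimap{!b})$, $\mathbf D=\bigwedge_a({!a}\multimap a)$ and $\delta=\bigwedge_a({!a}\multimap{!!a})$. *)

theory Defs
  imports Main
begin

locale implicative_structure =
  fixes imp :: "'a::complete_lattice \<Rightarrow> 'a \<Rightarrow> 'a"  (infixr "\<multimap>" 60)
  assumes imp_mono: "\<And>a a' b b'. a' \<le> a \<Longrightarrow> b \<le> b' \<Longrightarrow> (a \<multimap> b) \<le> (a' \<multimap> b')"
    and imp_Inf: "\<And>a B. (a \<multimap> Inf B) = (INF b\<in>B. a \<multimap> b)"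

locale exponential_implicative_structure = implicative_structure imp
  for imp :: "'a::complete_lattice \<Rightarrow> 'a \<Rightarrow> 'a"  (infixr "\<multimap>" 60) +
  fixes bang :: "'a \<Rightarrow> 'a"
  assumes bang_mono: "mono bang"

locale linear_separator = implicative_structure imp
  for imp :: "'a::complete_lattice \<Rightarrow> 'a \<Rightarrow> 'a"  (infixr "\<multimap>" 60) +
  fixes S :: "'a set"
  assumes upward_closed: "\<And>a b. a \<in> S \<Longrightarrow> a \<le> b \<Longrightarrow> b \<in> S"
    and modus_ponens: "\<And>a b. a \<in> S \<Longrightarrow> (a \<multimap> b) \<in> S \<Longrightarrow> b \<in> S"
    and I_in: "(INF a. a \<multimap> a) \<in> S"
    and B_in: "(INF a b c. (b \<multimap> c) \<multimap> (a \<multimap> b) \<multimap> a \<multimap> c) \<in> S"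
    and C_in: "(INF a b c. (a \<multimap> b \<multimap> c) \<multimap> b \<multimap> a \<multimap> c) \<in> S"

locale exponential_separator =
  exponential_implicative_structure imp bang + linear_separator imp S
  for imp :: "'a::complete_lattice \<Rightarrow> 'a \<Rightarrow> 'a"  (infixr "\<multimap>" 60)
    and bang :: "'a \<Rightarrow> 'a"
    and S :: "'a set" +
  assumes bang_closed: "\<And>a. a \<in> S \<Longrightarrow> bang a \<in> S"
    and K_bang_in: "(INF a b. a \<multimap> bang b \<multimap> a) \<in> S"
    and W_bang_in: "(INF a b. (bang a \<multimap> bang a \<multimap> b) \<multimap> bang a \<multimap> b) \<in> S"
    and F_in: "(INF a b. bang (a \<multimap> b) \<multimap> bang a \<multimap> bang b) \<in> S"
    and D_in: "(INF a. bang a \<multimap> a) \<in> S"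
    and delta_in: "(INF a. bang a \<multimap> bang (bang a)) \<in> S"

locale intuitionistic_separator = implicative_structure imp
  for imp :: "'a::complete_lattice \<Rightarrow> 'a \<Rightarrow> 'a"  (infixr "\<leadsto>" 60) +
  fixes S :: "'a set"
  assumes upward_closed: "\<And>a b. a \<in> S \<Longrightarrow> a \<le> b \<Longrightarrow> b \<in> S"
    and modus_ponens: "\<And>a b. a \<in> S \<Longrightarrow> (a \<leadsto> b) \<in> S \<Longrightarrow> b \<in> S"
    and K_in: "(INF a b. a \<leadsto> b \<leadsto> a) \<in> S"
    and S_in: "(INF a b c. (a \<leadsto> b \<leadsto> c) \<leadsto> (a \<leadsto> b) \<leadsto> a \<leadsto> c) \<in> S"

definition bang_imp :: "('a \<Rightarrow> 'a \<Rightarrow> 'a) \<Rightarrow> ('a \<Rightarrow> 'a) \<Rightarrow> 'a \<Rightarrow> 'a \<Rightarrow> 'a"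
  where "bang_imp imp bang a b = imp (bang a) b"

end

theory Submission
  imports Defs
begin

text \<open>
  Work with families \<open>f i\<close> realized uniformly, meaning \<open>(INF i. f i) \<in> S\<close>.
  Since \<open>\<multimap>\<close> is antitone on the left and commutes with meets on the right,
  uniform realizability is closed under modus ponens, so the combinators can be computed with
  as in a Hilbert system. Then \<open>\<^bold>K'\<close> is \<open>\<^bold>D\<close> followed by \<open>\<^bold>K\<^sub>!\<close>. For \<open>\<^bold>S'\<close>,
  \<open>\<^bold>F\<close> and \<open>\<delta>\<close> turn \<open>!(!a \<multimap> b)\<close> into \<open>!a \<multimap> !b\<close>; composing with \<open>!b \<multimap> !a \<multimap> c\<close> gives
  \<open>!a \<multimap> !a \<multimap> c\<close>, and \<open>\<^bold>W\<^sub>!\<close> contracts the two copies of \<open>!a\<close>.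
\<close>

text \<open>Monotonicity of \<open>bang\<close> keeps the left argument antitone; meets occur only
  on the right, where \<open>imp_Inf\<close> at \<open>bang a\<close> applies directly.\<close>

lemma (in exponential_implicative_structure) implicative_structure_bang_imp:
  "implicative_structure (bang_imp imp bang)"
proof
  show "bang_imp imp bang a b \<le> bang_imp imp bang a' b'" if "a' \<le> a" "b \<le> b'" for a a' b b'
    unfolding bang_imp_def using that by (intro imp_mono monoD[OF bang_mono])
  show "bang_imp imp bang a (Inf B) = (INF b\<in>B. bang_imp imp bang a b)" for a B
    unfolding bang_imp_def by (rule imp_Inf)
qed

context linear_separator
begin

lemma uniform_mp:
  assumes "(INF i. f i) \<in> S" "(INF i. f i \<multimap> g i) \<in> S"
  shows "(INF i. g i) \<in> S"
proof (rule modus_ponens[OF assms(1)])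
  have "(INF i. f i \<multimap> g i) \<le> (INF i. (INF j. f j) \<multimap> g i)"
    by (intro INF_mono' imp_mono INF_lower order_refl UNIV_I)
  also have "\<dots> = ((INF i. f i) \<multimap> (INF i. g i))"
    by (simp add: imp_Inf image_image)
  finally show "((INF i. f i) \<multimap> (INF i. g i)) \<in> S"
    using assms(2) upward_closed by blast
qed

text \<open>The meet in \<open>B_in\<close> runs over all triples, so it lies below every family of
  instances. The free index type lets the same argument serve pairs and triples later.\<close>

lemma uniform_B: "(INF i. (g i \<multimap> h i) \<multimap> (f i \<multimap> g i) \<multimap> f i \<multimap> h i) \<in> S"
  by (rule upward_closed[OF B_in]) (auto intro!: INF_greatest intro: INF_lower2)

lemma uniform_C: "(INF i. (f i \<multimap> g i \<multimap> h i) \<multimap> g i \<multimap> f i \<multimap> h i) \<in> S"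
  by (rule upward_closed[OF C_in]) (auto intro!: INF_greatest intro: INF_lower2)

lemma uniform_postcomp:
  assumes "(INF i. g i \<multimap> h i) \<in> S"
  shows "(INF i. (f i \<multimap> g i) \<multimap> f i \<multimap> h i) \<in> S"
  by (rule uniform_mp[OF assms uniform_B])

text \<open>Exchanging the first two arguments of \<open>uniform_B\<close> by
  \<open>uniform_C\<close> puts \<open>f i \<multimap> g i\<close> in front, ready for modus
  ponens.\<close>

lemma uniform_precomp:
  assumes "(INF i. f i \<multimap> g i) \<in> S"
  shows "(INF i. (g i \<multimap> h i) \<multimap> f i \<multimap> h i) \<in> S"
  by (rule uniform_mp[OF assms uniform_mp[OF uniform_B uniform_C]])

lemma uniform_trans:
  assumes "(INF i. f i \<multimap> g i) \<in> S" "(INF i. g i \<multimap> h i) \<in> S"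
  shows "(INF i. f i \<multimap> h i) \<in> S"
  by (rule uniform_mp[OF assms(1) uniform_postcomp[OF assms(2)]])

end

context exponential_separator
begin

lemma uniform_K: "(INF i. f i \<multimap> bang (g i) \<multimap> f i) \<in> S"
  by (rule upward_closed[OF K_bang_in]) (auto intro!: INF_greatest intro: INF_lower2)

lemma uniform_W: "(INF i. (bang (f i) \<multimap> bang (f i) \<multimap> g i) \<multimap> bang (f i) \<multimap> g i) \<in> S"
  by (rule upward_closed[OF W_bang_in]) (auto intro!: INF_greatest intro: INF_lower2)

lemma uniform_F: "(INF i. bang (f i \<multimap> g i) \<multimap> bang (f i) \<multimap> bang (g i)) \<in> S"
  by (rule upward_closed[OF F_in]) (auto intro!: INF_greatest intro: INF_lower2)

lemma uniform_D: "(INF i. bang (f i) \<multimap> f i) \<in> S"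
  by (rule upward_closed[OF D_in]) (auto intro!: INF_greatest intro: INF_lower2)

lemma uniform_delta: "(INF i. bang (f i) \<multimap> bang (bang (f i))) \<in> S"
  by (rule upward_closed[OF delta_in]) (auto intro!: INF_greatest intro: INF_lower2)

text \<open>\<open>uniform_F\<close> alone leaves \<open>bang (bang (f i))\<close> as the
  antecedent; precomposing with \<open>uniform_delta\<close> removes the extra
  \<open>bang\<close>.\<close>

lemma uniform_promotion: "(INF i. bang (bang (f i) \<multimap> g i) \<multimap> bang (f i) \<multimap> bang (g i)) \<in> S"
  by (rule uniform_trans[OF uniform_F uniform_precomp[OF uniform_delta]])

lemma uniform_K': "(INF i. bang (f i) \<multimap> bang (g i) \<multimap> f i) \<in> S"
  by (rule uniform_trans[OF uniform_D uniform_K])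

lemma uniform_S':
  "(INF i. bang (bang (f i) \<multimap> bang (g i) \<multimap> h i) \<multimap> bang (bang (f i) \<multimap> g i)
      \<multimap> bang (f i) \<multimap> h i) \<in> S"
proof -
  \<comment> \<open>After \<open>uniform_D\<close> strips the outer \<open>bang\<close>,
    \<open>uniform_C\<close> moves \<open>bang (g i)\<close> to the front, so that
    \<open>uniform_B\<close> can feed it from \<open>bang (f i)\<close>; this creates the second
    copy of \<open>bang (f i)\<close>.\<close>
  have "(INF i. bang (bang (f i) \<multimap> bang (g i) \<multimap> h i) \<multimap>
      (bang (f i) \<multimap> bang (g i)) \<multimap> bang (f i) \<multimap> bang (f i) \<multimap> h i) \<in> S"
    by (rule uniform_trans[OF uniform_D uniform_trans[OF uniform_C uniform_B]])
  then have "(INF i. bang (bang (f i) \<multimap> bang (g i) \<multimap> h i) \<multimap>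
      (bang (f i) \<multimap> bang (g i)) \<multimap> bang (f i) \<multimap> h i) \<in> S"
    by (rule uniform_trans[OF _ uniform_postcomp[OF uniform_W]])
  \<comment> \<open>Only the second antecedent still differs from the goal;
    \<open>uniform_promotion\<close> supplies it from
    \<open>bang (bang (f i) \<multimap> g i)\<close>.\<close>
  then show ?thesis
    by (rule uniform_trans[OF _ uniform_precomp[OF uniform_promotion]])
qed

lemma K'_in: "(INF a b. bang a \<multimap> bang b \<multimap> a) \<in> S"
proof (rule upward_closed[OF uniform_K'])
  \<comment> \<open>Indexing by pairs, with the projections as families, makes every choice of
    \<open>a\<close> and \<open>b\<close> an instance.\<close>
  show "(INF (i::'a \<times> 'a). bang (fst i) \<multimap> bang (snd i) \<multimap> fst i) \<le>
      (INF a b. bang a \<multimap> bang b \<multimap> a)"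
    (is "(INF i. ?f i) \<le> _")
  proof (intro INF_greatest)
    fix a b
    show "(INF i. ?f i) \<le> (bang a \<multimap> bang b \<multimap> a)"
      using INF_lower[of "(a, b)" UNIV ?f] by simp
  qed
qed

lemma S'_in:
  "(INF a b c. bang (bang a \<multimap> bang b \<multimap> c) \<multimap> bang (bang a \<multimap> b) \<multimap> bang a \<multimap> c) \<in> S"
proof (rule upward_closed[OF uniform_S'])
  show "(INF (i::'a \<times> 'a \<times> 'a). bang (bang (fst i) \<multimap> bang (fst (snd i)) \<multimap> snd (snd i)) \<multimap>
        bang (bang (fst i) \<multimap> fst (snd i)) \<multimap> bang (fst i) \<multimap> snd (snd i)) \<le>
      (INF a b c. bang (bang a \<multimap> bang b \<multimap> c) \<multimap> bang (bang a \<multimap> b) \<multimap> bang a \<multimap> c)"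
    (is "(INF i. ?f i) \<le> _")
  proof (intro INF_greatest)
    fix a b c
    show "(INF i. ?f i) \<le>
        (bang (bang a \<multimap> bang b \<multimap> c) \<multimap> bang (bang a \<multimap> b) \<multimap> bang a \<multimap> c)"
      using INF_lower[of "(a, b, c)" UNIV ?f] by simp
  qed
qed

text \<open>\<open>bang_closed\<close> puts \<open>bang a\<close> in \<open>S\<close>, which reduces
  this to linear modus ponens.\<close>

lemma bang_modus_ponens: "a \<in> S \<Longrightarrow> (bang a \<multimap> b) \<in> S \<Longrightarrow> b \<in> S"
  using modus_ponens bang_closed by blast

lemma intuitionistic_separator_bang_imp: "intuitionistic_separator (bang_imp imp bang) S"
  using implicative_structure_bang_imp upward_closed bang_modus_ponens K'_in S'_in
  unfolding intuitionistic_separator_def intuitionistic_separator_axioms_def bang_imp_def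
  by blast

end

theorem theorem4p1:
  fixes imp :: "'a::complete_lattice \<Rightarrow> 'a \<Rightarrow> 'a"  (infixr "\<multimap>" 60)
    and bang :: "'a \<Rightarrow> 'a"
  assumes "exponential_implicative_structure (\<multimap>) bang"
  shows "implicative_structure (bang_imp (\<multimap>) bang) \<and>
    (\<forall>S. exponential_separator (\<multimap>) bang S \<longrightarrow>
      intuitionistic_separator (bang_imp (\<multimap>) bang) S \<and>
      (\<forall>a b. a \<in> S \<longrightarrow> a \<le> b \<longrightarrow> b \<in> S) \<and>
      (\<forall>a b. a \<in> S \<longrightarrow> (bang a \<multimap> b) \<in> S \<longrightarrow> b \<in> S) \<and>
      (INF a b. bang a \<multimap> bang b \<multimap> a) \<in> S \<and>
      (INF a b c. bang (bang a \<multimap> bang b \<multimap> c) \<multimap> bang (bang a \<multimap> b) \<multimap> bang a \<multimap> c) \<in> S)"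
proof (intro conjI[OF exponential_implicative_structure.implicative_structure_bang_imp[OF assms]]
    allI impI)
  fix S
  assume "exponential_separator (\<multimap>) bang S"
  then interpret exponential_separator "(\<multimap>)" bang S .
  show "intuitionistic_separator (bang_imp (\<multimap>) bang) S \<and>
      (\<forall>a b. a \<in> S \<longrightarrow> a \<le> b \<longrightarrow> b \<in> S) \<and>
      (\<forall>a b. a \<in> S \<longrightarrow> (bang a \<multimap> b) \<in> S \<longrightarrow> b \<in> S) \<and>
      (INF a b. bang a \<multimap> bang b \<multimap> a) \<in> S \<and>
      (INF a b c. bang (bang a \<multimap> bang b \<multimap> c) \<multimap> bang (bang a \<multimap> b) \<multimap> bang a \<multimap> c) \<in> S"
    using intuitionistic_separator_bang_imp upward_closed bang_modus_ponens K'_in S'_in by blast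
qed

end
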